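(* Let $m\ge 2$ and let $L_m=\langle a,t \mid a^m,\ [t^{i}at^{-i},t^{j}at^{-j}],\ i,j\in\mathbb{Z}\rangle$. There is a language of geodesic words for $L_m$ with respect to the generating set $\{a,t\}$ which contains exactly one representative of each element of $L_m$ and which is accepted by a 1-counter automaton.
   Context: $L_m$ is the lamplighter group, i.e. the wreath product $\mathbb{Z}_m\wr\mathbb{Z}$, where $a$ generates $\mathbb{Z}_m$ and $t$ generates $\mathbb{Z}$. For a group $G$ with finite generating set $X$, words are finite strings over the alphabet $X\cup X^{-1}$ (as a subset of $G$); a word is geodesic if its length equals the word length (with respect to $X$) of the element it represents. For a group $H$ and a finite alphabet $A$, a (non-deterministic) $H$-automaton over $A$ is a finite directed graph with a distinguished start vertex, some distinguished accept vertices, and edges labelled by elements of $(A\cup\{\epsilon\})\times H$, where $\epsilon$ is the empty string. For a path $p$, $w(p)$ is the word obtained by concatenating the first components of its edge labels and $g(p)\in H$ is the product of the second components (the empty path gives the empty word and the identity). The automaton accepts a word $w$ if there is a path $p$ from the start vertex to an accept vertex with $w(p)=w$ and $g(p)=1$ in $H$. A 1-counter automaton is a $\mathbb{Z}$-automaton. *)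

theory Defs
  imports "HOL-Algebra.Elementary_Groups"
begin

section \<open>Groups given by a presentation\<close>

text \<open>
  A group word over a set of symbols is a list of pairs: \<open>(x, True)\<close> stands for \<open>x\<close> and
  \<open>(x, False)\<close> for the formal inverse of \<open>x\<close>. The group presented by the relators \<open>R\<close>
  is the quotient of the monoid of all group words by the smallest congruence that performs free
  cancellation and identifies each relator with the empty word.
\<close>

type_synonym 'x gword = "('x \<times> bool) list"

definition inv_gword :: "'x gword \<Rightarrow> 'x gword" where
  "inv_gword w = rev (map (\<lambda>(x, b). (x, \<not> b)) w)"

definition comm_gword :: "'x gword \<Rightarrow> 'x gword \<Rightarrow> 'x gword" where
  "comm_gword u v = inv_gword u @ inv_gword v @ u @ v"

definition gen_pow :: "'x \<Rightarrow> int \<Rightarrow> 'x gword" where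
  "gen_pow x i = replicate (nat \<bar>i\<bar>) (x, 0 \<le> i)"

inductive pres_eq :: "'x gword set \<Rightarrow> 'x gword \<Rightarrow> 'x gword \<Rightarrow> bool" for R where
  refl: "pres_eq R w w"
| sym: "pres_eq R v w \<Longrightarrow> pres_eq R w v"
| trans: "pres_eq R u v \<Longrightarrow> pres_eq R v w \<Longrightarrow> pres_eq R u w"
| cong: "pres_eq R u v \<Longrightarrow> pres_eq R (p @ u @ q) (p @ v @ q)"
| cancel: "pres_eq R [(x, b), (x, \<not> b)] []"
| relator: "r \<in> R \<Longrightarrow> pres_eq R r []"

definition pres_rel :: "'x gword set \<Rightarrow> 'x gword rel" where
  "pres_rel R = {(u, v). pres_eq R u v}"

definition presented_group :: "'x gword set \<Rightarrow> 'x gword set monoid" where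
  "presented_group R =
     \<lparr>carrier = UNIV // pres_rel R,
      monoid.mult = (\<lambda>U V. \<Union>u\<in>U. \<Union>v\<in>V. pres_rel R `` {u @ v}),
      one = pres_rel R `` {[]}\<rparr>"

definition pres_gen :: "'x gword set \<Rightarrow> 'x \<Rightarrow> 'x gword set" where
  "pres_gen R x = pres_rel R `` {[(x, True)]}"

lemma equiv_pres_rel: "equiv UNIV (pres_rel R)"
proof (intro equivI refl_onI symI transI)
  fix u v w assume "(u, v) \<in> pres_rel R" "(v, w) \<in> pres_rel R"
  then show "(u, w) \<in> pres_rel R"
    unfolding pres_rel_def by (auto dest: pres_eq.trans)
qed (simp_all add: pres_rel_def pres_eq.refl pres_eq.sym)

lemma pres_class_eq_iff: "pres_rel R `` {u} = pres_rel R `` {v} \<longleftrightarrow> pres_eq R u v"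
  using eq_equiv_class_iff[OF equiv_pres_rel, of u v R] by (simp add: pres_rel_def)

lemma pres_eq_append:
  assumes "pres_eq R u u'" "pres_eq R v v'"
  shows "pres_eq R (u @ v) (u' @ v')"
proof (rule pres_eq.trans)
  show "pres_eq R (u @ v) (u' @ v)"
    using pres_eq.cong[OF assms(1), of "[]" v] by simp
  show "pres_eq R (u' @ v) (u' @ v')"
    using pres_eq.cong[OF assms(2), of u' "[]"] by simp
qed

lemma pres_mult_class:
  "pres_rel R `` {u} \<otimes>\<^bsub>presented_group R\<^esub> pres_rel R `` {v} = pres_rel R `` {u @ v}"
proof -
  have "pres_rel R `` {u' @ v'} = pres_rel R `` {u @ v}"
    if "u' \<in> pres_rel R `` {u}" "v' \<in> pres_rel R `` {v}" for u' v'
  proof -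
    have "pres_eq R u u'" "pres_eq R v v'"
      using that by (simp_all add: pres_rel_def)
    then show ?thesis
      unfolding pres_class_eq_iff by (intro pres_eq.sym[OF pres_eq_append])
  qed
  then have "(\<Union>u'\<in>pres_rel R `` {u}. \<Union>v'\<in>pres_rel R `` {v}. pres_rel R `` {u' @ v'})
      = (\<Union>u'\<in>pres_rel R `` {u}. \<Union>v'\<in>pres_rel R `` {v}. pres_rel R `` {u @ v})"
    by (intro SUP_cong HOL.refl)
  also have "\<dots> = pres_rel R `` {u @ v}"
  proof -
    have "pres_rel R `` {u} \<noteq> {}" "pres_rel R `` {v} \<noteq> {}"
      using pres_eq.refl[of R] by (auto simp: pres_rel_def)
    then show ?thesis by simp
  qed
  finally show ?thesis
    by (simp add: presented_group_def)
qed

lemma pres_eq_inv: "pres_eq R (inv_gword w @ w) []"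
proof (induction w)
  case Nil
  then show ?case by (simp add: inv_gword_def pres_eq.refl)
next
  case (Cons c w)
  obtain x b where c: "c = (x, b)" by fastforce
  have "pres_eq R (inv_gword w @ [(x, \<not> b), (x, \<not> \<not> b)] @ w) (inv_gword w @ [] @ w)"
    by (intro pres_eq.cong pres_eq.cancel)
  then have "pres_eq R (inv_gword (c # w) @ c # w) (inv_gword w @ w)"
    by (simp add: c inv_gword_def)
  from this Cons.IH show ?case
    by (rule pres_eq.trans)
qed

lemma carrier_presented_groupE:
  assumes "U \<in> carrier (presented_group R)"
  obtains u where "U = pres_rel R `` {u}"
  using assms by (auto simp: presented_group_def elim: quotientE)

lemma class_in_carrier: "pres_rel R `` {u} \<in> carrier (presented_group R)"
  by (auto simp: presented_group_def intro: quotientI)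

lemma one_presented_group: "\<one>\<^bsub>presented_group R\<^esub> = pres_rel R `` {[]}"
  by (simp add: presented_group_def)

lemma group_presented_group: "group (presented_group R)"
proof (rule groupI)
  fix U assume "U \<in> carrier (presented_group R)"
  then obtain u where u: "U = pres_rel R `` {u}" by (rule carrier_presented_groupE)
  have "pres_rel R `` {inv_gword u} \<otimes>\<^bsub>presented_group R\<^esub> U = \<one>\<^bsub>presented_group R\<^esub>"
    by (simp add: u pres_mult_class one_presented_group pres_class_eq_iff pres_eq_inv)
  then show "\<exists>V\<in>carrier (presented_group R).
      V \<otimes>\<^bsub>presented_group R\<^esub> U = \<one>\<^bsub>presented_group R\<^esub>"
    using class_in_carrier by blast
next
  fix U V W
  assume "U \<in> carrier (presented_group R)" "V \<in> carrier (presented_group R)"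
    "W \<in> carrier (presented_group R)"
  then obtain u v w where "U = pres_rel R `` {u}" "V = pres_rel R `` {v}" "W = pres_rel R `` {w}"
    by (metis carrier_presented_groupE)
  then show "U \<otimes>\<^bsub>presented_group R\<^esub> V \<otimes>\<^bsub>presented_group R\<^esub> W =
      U \<otimes>\<^bsub>presented_group R\<^esub> (V \<otimes>\<^bsub>presented_group R\<^esub> W)"
    by (simp add: pres_mult_class)
next
  fix U V
  assume "U \<in> carrier (presented_group R)" "V \<in> carrier (presented_group R)"
  then obtain u v where "U = pres_rel R `` {u}" "V = pres_rel R `` {v}"
    by (metis carrier_presented_groupE)
  then show "U \<otimes>\<^bsub>presented_group R\<^esub> V \<in> carrier (presented_group R)"
    by (simp add: pres_mult_class class_in_carrier)
next
  fix U assume "U \<in> carrier (presented_group R)"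
  then obtain u where "U = pres_rel R `` {u}" by (rule carrier_presented_groupE)
  then show "\<one>\<^bsub>presented_group R\<^esub> \<otimes>\<^bsub>presented_group R\<^esub> U = U"
    by (simp add: pres_mult_class one_presented_group)
qed (simp add: one_presented_group class_in_carrier)

section \<open>The lamplighter group\<close>

datatype lamp_sym = SymA | SymT

text \<open>\<open>lamp_conj i\<close> is the word \<open>t\<^sup>i a t\<^sup>-\<^sup>i\<close>.\<close>

definition lamp_conj :: "int \<Rightarrow> lamp_sym gword" where
  "lamp_conj i = gen_pow SymT i @ [(SymA, True)] @ gen_pow SymT (- i)"

definition lamp_relators :: "nat \<Rightarrow> lamp_sym gword set" where
  "lamp_relators m =
     insert (gen_pow SymA (int m)) {comm_gword (lamp_conj i) (lamp_conj j) | i j. True}"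

definition lamplighter :: "nat \<Rightarrow> lamp_sym gword set monoid" where
  "lamplighter m = presented_group (lamp_relators m)"

definition lamp_a :: "nat \<Rightarrow> lamp_sym gword set" where
  "lamp_a m = pres_gen (lamp_relators m) SymA"

definition lamp_t :: "nat \<Rightarrow> lamp_sym gword set" where
  "lamp_t m = pres_gen (lamp_relators m) SymT"

section \<open>Geodesic words\<close>

text \<open>
  Letters are elements of the group, so a generator of order two and its inverse are
  one and the same letter.
\<close>

definition alphabet :: "('g, 'b) monoid_scheme \<Rightarrow> 'g set \<Rightarrow> 'g set" where
  "alphabet G X = X \<union> m_inv G ` X"

definition word_value :: "('g, 'b) monoid_scheme \<Rightarrow> 'g list \<Rightarrow> 'g" where
  "word_value G w = foldr (monoid.mult G) w \<one>\<^bsub>G\<^esub>"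

definition word_length :: "('g, 'b) monoid_scheme \<Rightarrow> 'g set \<Rightarrow> 'g \<Rightarrow> nat" where
  "word_length G X g =
     (LEAST n. \<exists>w \<in> lists (alphabet G X). length w = n \<and> word_value G w = g)"

definition geodesic :: "('g, 'b) monoid_scheme \<Rightarrow> 'g set \<Rightarrow> 'g list \<Rightarrow> bool" where
  "geodesic G X w \<longleftrightarrow>
     w \<in> lists (alphabet G X) \<and> length w = word_length G X (word_value G w)"

section \<open>Automata over a group\<close>

text \<open>
  An edge is a tuple of source, letter, group element and target, where the letter \<open>None\<close> is the
  empty string. Parallel edges with equal labels would not change the accepted language.
\<close>

type_synonym ('v, 'a, 'h) edge = "'v \<times> 'a option \<times> 'h \<times> 'v"

record ('v, 'a, 'h) automaton =
  verts :: "'v set"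
  start :: 'v
  accepting :: "'v set"
  edges :: "('v, 'a, 'h) edge set"

definition group_automaton ::
    "('h, 'b) monoid_scheme \<Rightarrow> 'a set \<Rightarrow> ('v, 'a, 'h) automaton \<Rightarrow> bool" where
  "group_automaton H A M \<longleftrightarrow>
     finite (verts M) \<and> start M \<in> verts M \<and> accepting M \<subseteq> verts M \<and> finite (edges M) \<and>
     edges M \<subseteq> verts M \<times> insert None (Some ` A) \<times> carrier H \<times> verts M"

fun is_path ::
    "('v, 'a, 'h) automaton \<Rightarrow> 'v \<Rightarrow> ('v, 'a, 'h) edge list \<Rightarrow> 'v \<Rightarrow> bool" where
  "is_path M u [] v \<longleftrightarrow> u = v"
| "is_path M u ((s, l, h, s') # p) v \<longleftrightarrow> (s, l, h, s') \<in> edges M \<and> s = u \<and> is_path M s' p v"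

definition path_word :: "('v, 'a, 'h) edge list \<Rightarrow> 'a list" where
  "path_word p = concat (map (\<lambda>(_, l, _, _). case l of None \<Rightarrow> [] | Some x \<Rightarrow> [x]) p)"

definition path_elem ::
    "('h, 'b) monoid_scheme \<Rightarrow> ('v, 'a, 'h) edge list \<Rightarrow> 'h" where
  "path_elem H p = word_value H (map (\<lambda>(_, _, h, _). h) p)"

definition accepted_language ::
    "('h, 'b) monoid_scheme \<Rightarrow> ('v, 'a, 'h) automaton \<Rightarrow> 'a list set" where
  "accepted_language H M =
     {w. \<exists>p. \<exists>v \<in> accepting M.
           is_path M (start M) p v \<and> path_word p = w \<and> path_elem H p = \<one>\<^bsub>H\<^esub>}"

text \<open>
  Vertices are taken to be natural numbers; a finite graph can always be renamed in this way.
\<close>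

definition one_counter_language :: "'a set \<Rightarrow> 'a list set \<Rightarrow> bool" where
  "one_counter_language A L \<longleftrightarrow>
     (\<exists>M :: (nat, 'a, int) automaton.
        group_automaton integer_group A M \<and> accepted_language integer_group M = L)"

end

theory Submission
  imports Defs
begin

text \<open>An element of the lamplighter group is a lamp configuration together with a cursor position
  \<open>n\<close>. Let \<open>[-l, h]\<close> be the smallest interval containing \<open>0\<close>, \<open>n\<close> and all lit lamps. If \<open>n \<ge> 0\<close>, then a
  word for this element has at least \<open>2l + 2h - n\<close> letters \<open>t\<^sup>\<plusminus>\<^sup>1\<close>, and this is achieved by running to
  \<open>-l\<close>, then sweeping up to \<open>h\<close> while setting the lamps, then returning to \<open>n\<close>; if \<open>n < 0\<close>, the mirror
  image is shortest. Words of this shape with nonzero lamps at the turning points form a regular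
  set, in which the only further condition is the sign of the final cursor position. The latter is
  checked by a counter that follows the cursor and is brought to \<open>0\<close> at the end by
  \<open>\<epsilon>\<close>-edges of one sign.\<close>

section \<open>The word problem\<close>

abbreviation lamp_class :: "nat \<Rightarrow> lamp_sym gword \<Rightarrow> lamp_sym gword set" where
  "lamp_class m w \<equiv> pres_rel (lamp_relators m) `` {w}"

lemma group_lamplighter: "group (lamplighter m)"
  unfolding lamplighter_def by (rule group_presented_group)

lemma lamp_class_append:
  "lamp_class m (u @ v) = lamp_class m u \<otimes>\<^bsub>lamplighter m\<^esub> lamp_class m v"
  by (simp add: lamplighter_def pres_mult_class)

lemma lamp_class_Nil: "lamp_class m [] = \<one>\<^bsub>lamplighter m\<^esub>"
  by (simp add: lamplighter_def one_presented_group)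

lemma lamp_class_carrier: "lamp_class m w \<in> carrier (lamplighter m)"
  unfolding lamplighter_def by (rule class_in_carrier)

lemma lamp_class_inv_gword:
  "lamp_class m (inv_gword w) = inv\<^bsub>lamplighter m\<^esub> (lamp_class m w)"
proof -
  have "lamp_class m (inv_gword w) \<otimes>\<^bsub>lamplighter m\<^esub> lamp_class m w = \<one>\<^bsub>lamplighter m\<^esub>"
    unfolding lamp_class_append[symmetric] lamp_class_Nil[symmetric] pres_class_eq_iff
    by (rule pres_eq_inv)
  then show ?thesis
    by (intro HOL.sym[OF group.inv_equality[OF group_lamplighter]] lamp_class_carrier)
qed

lemma lamp_class_gen_pow:
  "lamp_class m (gen_pow x i) = lamp_class m [(x, True)] [^]\<^bsub>lamplighter m\<^esub> i"
proof -
  interpret group "lamplighter m" by (rule group_lamplighter)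
  have nat: "lamp_class m (replicate n (x, True)) =
      lamp_class m [(x, True)] [^]\<^bsub>lamplighter m\<^esub> n" for n
  proof (induction n)
    case (Suc n)
    have "replicate (Suc n) (x, True) = replicate n (x, True) @ [(x, True)]"
      by (simp add: replicate_append_same)
    then show ?case by (simp only: lamp_class_append Suc nat_pow_Suc)
  qed (simp add: lamp_class_Nil)
  show ?thesis
  proof (cases i rule: int_cases2)
    case (nonneg n)
    then have "gen_pow x i = replicate n (x, True)"
      by (simp add: gen_pow_def)
    then show ?thesis
      by (simp only: nat nonneg int_pow_int)
  next
    case (nonpos n)
    then have "gen_pow x i = inv_gword (replicate n (x, True))"
      by (cases "n = 0") (simp_all add: gen_pow_def inv_gword_def)
    then show ?thesis
      by (simp only: lamp_class_inv_gword nat nonpos int_pow_neg_int[OF lamp_class_carrier])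
  qed
qed

definition sgn_of :: "bool \<Rightarrow> int" where
  "sgn_of b = (if b then 1 else - 1)"

lemma lamp_class_letter:
  "lamp_class m [(x, b)] = lamp_class m [(x, True)] [^]\<^bsub>lamplighter m\<^esub> sgn_of b"
  using lamp_class_gen_pow[of m x "sgn_of b"] by (cases b) (simp_all add: gen_pow_def sgn_of_def)

section \<open>Invariants of a word: displacement of the cursor and lamp configuration\<close>

fun cursor :: "lamp_sym gword \<Rightarrow> int" where
  "cursor [] = 0"
| "cursor ((SymT, b) # w) = sgn_of b + cursor w"
| "cursor ((SymA, b) # w) = cursor w"

text \<open>Lamp values stay integers and are reduced modulo \<open>m\<close> only when elements are
  compared. The unreduced values bound the number of letters \<open>a\<close> from below.\<close>

fun lamp :: "lamp_sym gword \<Rightarrow> int \<Rightarrow> int" where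
  "lamp [] i = 0"
| "lamp ((SymT, b) # w) i = lamp w (i - sgn_of b)"
| "lamp ((SymA, b) # w) i = (if i = 0 then sgn_of b else 0) + lamp w i"

lemma cursor_append [simp]: "cursor (u @ v) = cursor u + cursor v"
  by (induction u rule: cursor.induct) auto

lemma lamp_append [simp]: "lamp (u @ v) i = lamp u i + lamp v (i - cursor u)"
  by (induction u arbitrary: i rule: cursor.induct) (auto simp: algebra_simps)

lemma cursor_replicate_SymT [simp]: "cursor (replicate n (SymT, b)) = sgn_of b * int n"
  by (induction n) (auto simp: algebra_simps)

lemma lamp_replicate_SymT [simp]: "lamp (replicate n (SymT, b)) i = 0"
  by (induction n arbitrary: i) auto

lemma cursor_replicate_SymA [simp]: "cursor (replicate n (SymA, b)) = 0"
  by (induction n) auto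

lemma lamp_replicate_SymA [simp]:
  "lamp (replicate n (SymA, b)) i = (if i = 0 then sgn_of b * int n else 0)"
  by (induction n) (auto simp: algebra_simps)

lemma cursor_gen_pow_SymT [simp]: "cursor (gen_pow SymT i) = i"
  by (simp add: gen_pow_def sgn_of_def)

lemma lamp_gen_pow_SymT [simp]: "lamp (gen_pow SymT j) i = 0"
  by (simp add: gen_pow_def)

lemma cursor_gen_pow_SymA [simp]: "cursor (gen_pow SymA c) = 0"
  by (simp add: gen_pow_def)

lemma lamp_gen_pow_SymA [simp]: "lamp (gen_pow SymA c) i = (if i = 0 then c else 0)"
  by (simp add: gen_pow_def sgn_of_def)

lemma inv_gword_Nil [simp]: "inv_gword [] = []"
  by (simp add: inv_gword_def)

lemma inv_gword_Cons [simp]: "inv_gword ((x, b) # w) = inv_gword w @ [(x, \<not> b)]"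
  by (simp add: inv_gword_def)

lemma cursor_inv_gword [simp]: "cursor (inv_gword w) = - cursor w"
  by (induction w rule: cursor.induct) (auto simp: sgn_of_def)

lemma lamp_inv_gword [simp]: "lamp (inv_gword w) i = - lamp w (i + cursor w)"
  by (induction w arbitrary: i rule: cursor.induct) (auto simp: sgn_of_def algebra_simps)

text \<open>Every rule of the congruence is checked on the invariants. Only the relator
  \<open>a^m\<close> alters a lamp, namely lamp 0 by \<open>m\<close>; in a commutator of two
  conjugates all displacements are 0 and the lamp values cancel.\<close>

lemma pres_eq_cursor_lamp:
  assumes "pres_eq (lamp_relators m) u v"
  shows "cursor u = cursor v \<and> (\<forall>i. int m dvd lamp u i - lamp v i)"
  using assms
proof induction
  case (refl w)
  show ?case by simp
next
  case (cong u v p q)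
  then show ?case by simp
next
  case (sym u v)
  then show ?case by (metis dvd_diff_commute)
next
  case (trans u v w)
  have "int m dvd lamp u i - lamp w i" for i
    using dvd_add[of "int m" "lamp u i - lamp v i" "lamp v i - lamp w i"] trans by simp
  then show ?case using trans by simp
next
  case (cancel x b)
  show ?case by (cases x) (auto simp: sgn_of_def)
next
  case (relator r)
  then show ?case
    by (auto simp: lamp_relators_def comm_gword_def lamp_conj_def)
qed

section \<open>Normal forms: products of conjugates of \<open>a\<close> and a power of
  \<open>t\<close>\<close>

definition lamp_switch :: "int \<times> bool \<Rightarrow> lamp_sym gword" where
  "lamp_switch = (\<lambda>(i, b). gen_pow SymT i @ [(SymA, b)] @ gen_pow SymT (- i))"

lemma lamp_lamp_switch: "lamp (lamp_switch (j, b)) i = (if i = j then sgn_of b else 0)"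
  by (simp add: lamp_switch_def)

lemma cursor_lamp_switch [simp]: "cursor (lamp_switch p) = 0"
  by (simp add: lamp_switch_def split: prod.splits)

lemma cursor_lamp_switches [simp]: "cursor (concat (map lamp_switch ps)) = 0"
  by (induction ps) auto

lemma lamp_class_lamp_switch:
  "lamp_class m (lamp_switch (i, b)) =
     lamp_class m [(SymT, True)] [^]\<^bsub>lamplighter m\<^esub> i \<otimes>\<^bsub>lamplighter m\<^esub>
     (lamp_class m [(SymA, True)] [^]\<^bsub>lamplighter m\<^esub> sgn_of b \<otimes>\<^bsub>lamplighter m\<^esub>
     lamp_class m [(SymT, True)] [^]\<^bsub>lamplighter m\<^esub> (- i))"
  unfolding lamp_switch_def prod.case lamp_class_append lamp_class_gen_pow
  by (subst lamp_class_letter) (rule HOL.refl)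

text \<open>Letters are appended on the right. A letter \<open>t\<close> changes only the final
  power of \<open>t\<close>; a letter \<open>a\<close> at cursor position \<open>n\<close> is
  absorbed through \<open>t^n a = (t^n a t^(-n)) t^n\<close>, which adds one switch at
  \<open>n\<close>.\<close>

lemma lamp_class_eq_switches:
  "\<exists>ps. lamp_class m w = lamp_class m (concat (map lamp_switch ps) @ gen_pow SymT (cursor w))"
proof (induction w rule: rev_induct)
  case Nil
  then show ?case by (intro exI[of _ "[]"]) (simp add: gen_pow_def)
next
  case (snoc p w)
  interpret group "lamplighter m" by (rule group_lamplighter)
  obtain x b where p: "p = (x, b)" by fastforce
  obtain ps where IH:
    "lamp_class m w = lamp_class m (concat (map lamp_switch ps) @ gen_pow SymT (cursor w))"
    using snoc by blast
  show ?case
  proof (cases x)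
    case SymT
    have "lamp_class m (w @ [p]) =
        lamp_class m (concat (map lamp_switch ps) @ gen_pow SymT (cursor (w @ [p])))"
      by (simp add: p SymT lamp_class_append IH lamp_class_gen_pow lamp_class_carrier m_assoc
          lamp_class_letter[of m SymT b] int_pow_mult[symmetric])
    then show ?thesis by blast
  next
    case SymA
    have "lamp_class m (w @ [p]) =
        lamp_class m (concat (map lamp_switch (ps @ [(cursor w, b)])) @ gen_pow SymT (cursor (w @ [p])))"
      by (simp add: p SymA lamp_class_lamp_switch lamp_class_append IH lamp_class_letter[of m SymA b]
          lamp_class_gen_pow lamp_class_carrier m_assoc int_pow_mult[symmetric])
    then show ?thesis by blast
  qed
qed

lemma (in group) conj_pow_mult:
  fixes i k l :: int
  assumes "x \<in> carrier G" "y \<in> carrier G"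
  shows "(x [^] i \<otimes> (y [^] k \<otimes> x [^] (- i))) \<otimes> (x [^] i \<otimes> (y [^] l \<otimes> x [^] (- i))) =
    x [^] i \<otimes> (y [^] (k + l) \<otimes> x [^] (- i))"
  using assms by (simp add: m_assoc int_pow_mult int_pow_neg inv_solve_left)
    (simp add: m_assoc[symmetric])

lemma lamp_class_switches_single:
  assumes "\<And>p. p \<in> set ps \<Longrightarrow> fst p = i"
  shows "lamp_class m (concat (map lamp_switch ps)) =
     lamp_class m [(SymT, True)] [^]\<^bsub>lamplighter m\<^esub> i \<otimes>\<^bsub>lamplighter m\<^esub>
     (lamp_class m [(SymA, True)] [^]\<^bsub>lamplighter m\<^esub> (lamp (concat (map lamp_switch ps)) i)
      \<otimes>\<^bsub>lamplighter m\<^esub> lamp_class m [(SymT, True)] [^]\<^bsub>lamplighter m\<^esub> (- i))"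
  using assms
proof (induction ps)
  case Nil
  interpret group "lamplighter m" by (rule group_lamplighter)
  show ?case
    by (simp add: lamp_class_Nil lamp_class_carrier int_pow_mult[symmetric])
next
  case (Cons p ps)
  interpret group "lamplighter m" by (rule group_lamplighter)
  obtain b where p: "p = (i, b)"
    using Cons.prems[of p] by (cases p) auto
  show ?case
    using Cons conj_pow_mult[of "lamp_class m [(SymT, True)]" "lamp_class m [(SymA, True)]" i]
    by (simp add: p lamp_class_append lamp_class_lamp_switch lamp_lamp_switch lamp_class_carrier)
qed

lemma lamp_class_a_pow: "lamp_class m [(SymA, True)] [^]\<^bsub>lamplighter m\<^esub> m = \<one>\<^bsub>lamplighter m\<^esub>"
proof -
  have "lamp_class m (gen_pow SymA (int m)) = lamp_class m []"
    unfolding pres_class_eq_iff by (rule pres_eq.relator) (simp add: lamp_relators_def)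
  then show ?thesis
    by (simp only: lamp_class_gen_pow lamp_class_Nil int_pow_int)
qed

section \<open>Commuting switches and trivial products of switches\<close>

lemma (in group) commutes_inv:
  assumes "x \<otimes> y = y \<otimes> x" "x \<in> carrier G" "y \<in> carrier G"
  shows "inv x \<otimes> y = y \<otimes> inv x"
  using assms by (metis inv_closed inv_solve_left inv_solve_right m_assoc m_closed)

lemma (in group) commute_if_commutator_one:
  assumes "inv x \<otimes> (inv y \<otimes> (x \<otimes> y)) = \<one>" "x \<in> carrier G" "y \<in> carrier G"
  shows "x \<otimes> y = y \<otimes> x" "inv x \<otimes> y = y \<otimes> inv x" "x \<otimes> inv y = inv y \<otimes> x"
    "inv x \<otimes> inv y = inv y \<otimes> inv x"
proof -
  show "x \<otimes> y = y \<otimes> x"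
    using assms by (metis inv_closed inv_solve_left inv_solve_left' m_closed r_one)
  then show "inv x \<otimes> y = y \<otimes> inv x" "x \<otimes> inv y = inv y \<otimes> x"
    "inv x \<otimes> inv y = inv y \<otimes> inv x"
    using assms(2,3) by (metis commutes_inv inv_closed)+
qed

text \<open>The relators speak only of the positive conjugates \<open>lamp_conj i\<close>. A switch
  with sign \<open>False\<close> is the inverse of one of these, and commuting passes to
  inverses.\<close>

lemma lamp_class_switch_commute:
  "lamp_class m (lamp_switch p) \<otimes>\<^bsub>lamplighter m\<^esub> lamp_class m (lamp_switch q) =
   lamp_class m (lamp_switch q) \<otimes>\<^bsub>lamplighter m\<^esub> lamp_class m (lamp_switch p)"
proof -
  interpret group "lamplighter m" by (rule group_lamplighter)
  obtain i b j c where pq: "p = (i, b)" "q = (j, c)" by (metis surj_pair)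
  define x where "x = lamp_class m (lamp_conj i)"
  define y where "y = lamp_class m (lamp_conj j)"
  have carr [simp]: "x \<in> carrier (lamplighter m)" "y \<in> carrier (lamplighter m)"
    by (simp_all add: x_def y_def lamp_class_carrier)
  have switch: "lamp_class m (lamp_switch (k, d)) =
      (if d then lamp_class m (lamp_conj k)
       else inv\<^bsub>lamplighter m\<^esub> (lamp_class m (lamp_conj k)))" for k d
  proof -
    have "lamp_class m (lamp_conj k) = lamp_class m (lamp_switch (k, True))"
      by (simp add: lamp_conj_def lamp_switch_def)
    then show ?thesis
      by (simp add: lamp_class_lamp_switch sgn_of_def inv_mult_group lamp_class_carrier
          int_pow_neg m_assoc)
  qed
  have "lamp_class m (comm_gword (lamp_conj i) (lamp_conj j)) = lamp_class m []"
    unfolding pres_class_eq_iff by (rule pres_eq.relator) (auto simp: lamp_relators_def)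
  then have "inv\<^bsub>lamplighter m\<^esub> x \<otimes>\<^bsub>lamplighter m\<^esub> (inv\<^bsub>lamplighter m\<^esub> y
      \<otimes>\<^bsub>lamplighter m\<^esub> (x \<otimes>\<^bsub>lamplighter m\<^esub> y)) = \<one>\<^bsub>lamplighter m\<^esub>"
    unfolding comm_gword_def lamp_class_append lamp_class_inv_gword lamp_class_Nil x_def y_def .
  from commute_if_commutator_one[OF this carr] show ?thesis
    by (auto simp: pq switch x_def y_def)
qed

lemma lamp_class_switches_commute:
  "lamp_class m (lamp_switch p @ concat (map lamp_switch ps)) =
   lamp_class m (concat (map lamp_switch ps) @ lamp_switch p)"
proof (induction ps)
  case (Cons q ps)
  interpret group "lamplighter m" by (rule group_lamplighter)
  have "lamp_class m (lamp_switch p @ concat (map lamp_switch (q # ps))) =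
      lamp_class m (lamp_switch q) \<otimes>\<^bsub>lamplighter m\<^esub>
        lamp_class m (lamp_switch p @ concat (map lamp_switch ps))"
    by (simp add: lamp_class_append lamp_class_carrier m_assoc[symmetric]
        lamp_class_switch_commute[of m p q])
  then show ?case
    unfolding Cons by (simp add: lamp_class_append)
qed simp

lemma lamp_class_switches_partition:
  "lamp_class m (concat (map lamp_switch ps)) =
   lamp_class m (concat (map lamp_switch (filter P ps)) @
     concat (map lamp_switch (filter (\<lambda>p. \<not> P p) ps)))"
proof (induction ps)
  case (Cons p ps)
  interpret group "lamplighter m" by (rule group_lamplighter)
  show ?case
  proof (cases "P p")
    case True
    then show ?thesis
      using Cons by (simp add: lamp_class_append lamp_class_carrier m_assoc)
  next
    case False
    have "lamp_class m (concat (map lamp_switch (p # ps))) =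
        lamp_class m (lamp_switch p @ concat (map lamp_switch (filter P ps))) \<otimes>\<^bsub>lamplighter m\<^esub>
        lamp_class m (concat (map lamp_switch (filter (\<lambda>p. \<not> P p) ps)))"
      using Cons by (simp add: lamp_class_append lamp_class_carrier m_assoc)
    then show ?thesis
      unfolding lamp_class_switches_commute
      using False by (simp add: lamp_class_append lamp_class_carrier m_assoc)
  qed
qed simp

lemma lamp_switches_filter:
  "lamp (concat (map lamp_switch (filter P ps))) i =
     lamp (concat (map lamp_switch (filter (\<lambda>p. P p \<and> fst p = i) ps))) i"
  by (induction ps) (auto simp: lamp_lamp_switch)

text \<open>Induction on the number of switches. Those at the position of the first one are
  collected; they multiply to a conjugate of a power of \<open>a\<close> whose exponent is a
  multiple of \<open>m\<close>, hence to the identity. The others form a shorter list with the same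
  property.\<close>

lemma lamp_class_switches_eq_one:
  assumes "\<And>i. int m dvd lamp (concat (map lamp_switch ps)) i"
  shows "lamp_class m (concat (map lamp_switch ps)) = \<one>\<^bsub>lamplighter m\<^esub>"
  using assms
proof (induction ps rule: length_induct)
  case (1 ps)
  interpret group "lamplighter m" by (rule group_lamplighter)
  show ?case
  proof (cases ps)
    case Nil
    then show ?thesis by (simp add: lamp_class_Nil)
  next
    case (Cons p qs)
    define i where "i = fst p"
    let ?here = "filter (\<lambda>p. fst p = i) ps" and ?there = "filter (\<lambda>p. fst p \<noteq> i) ps"
    have "length ?there < length ps"
      by (rule length_filter_less[of p]) (auto simp: Cons i_def)
    \<comment> \<open>Removing the switches at \<open>i\<close> clears lamp \<open>i\<close> and
      leaves all other lamps unchanged.\<close>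
    moreover have "int m dvd lamp (concat (map lamp_switch ?there)) j" for j
    proof (cases "j = i")
      case True
      then show ?thesis
        using lamp_switches_filter[of "\<lambda>p. fst p \<noteq> i" ps i] by simp
    next
      case False
      then have "(\<lambda>p. fst p \<noteq> i \<and> fst p = j) = (\<lambda>p::int \<times> bool. fst p = j)" by auto
      then show ?thesis
        using lamp_switches_filter[of "\<lambda>p. fst p \<noteq> i" ps j]
          lamp_switches_filter[of "\<lambda>_. True" ps j] "1.prems"[of j] by simp
    qed
    ultimately have there: "lamp_class m (concat (map lamp_switch ?there)) = \<one>\<^bsub>lamplighter m\<^esub>"
      using "1.IH" by blast
    have "int m dvd lamp (concat (map lamp_switch ?here)) i"
      using lamp_switches_filter[of "\<lambda>_. True" ps i] "1.prems"[of i] by simp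
    then obtain k where k: "lamp (concat (map lamp_switch ?here)) i = int m * k" by auto
    have "lamp_class m [(SymA, True)] [^]\<^bsub>lamplighter m\<^esub> (int m * k) = \<one>\<^bsub>lamplighter m\<^esub>"
      using lamp_class_a_pow
      by (simp add: int_pow_pow[symmetric] lamp_class_carrier int_pow_int)
    then have "lamp_class m (concat (map lamp_switch ?here)) = \<one>\<^bsub>lamplighter m\<^esub>"
      by (subst lamp_class_switches_single[of _ i])
        (auto simp: k lamp_class_carrier int_pow_mult[symmetric])
    with there show ?thesis
      by (subst lamp_class_switches_partition[of m ps "\<lambda>p. fst p = i"])
        (simp add: lamp_class_append)
  qed
qed

text \<open>For the converse, \<open>inv_gword u @ v\<close> has displacement 0, so its normal form
  consists of switches only. By invariance their lamp values, too, are divisible by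
  \<open>m\<close>, and the product is trivial.\<close>

theorem lamp_class_eq_iff:
  "lamp_class m u = lamp_class m v \<longleftrightarrow>
     cursor u = cursor v \<and> (\<forall>i. int m dvd lamp u i - lamp v i)"
proof
  assume "lamp_class m u = lamp_class m v"
  then show "cursor u = cursor v \<and> (\<forall>i. int m dvd lamp u i - lamp v i)"
    unfolding pres_class_eq_iff by (rule pres_eq_cursor_lamp)
next
  assume same: "cursor u = cursor v \<and> (\<forall>i. int m dvd lamp u i - lamp v i)"
  interpret group "lamplighter m" by (rule group_lamplighter)
  let ?w = "inv_gword u @ v"
  obtain ps where
    "lamp_class m ?w = lamp_class m (concat (map lamp_switch ps) @ gen_pow SymT (cursor ?w))"
    using lamp_class_eq_switches by blast
  moreover have "gen_pow SymT (cursor ?w) = []"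
    using same by (simp add: gen_pow_def)
  ultimately have ps: "lamp_class m ?w = lamp_class m (concat (map lamp_switch ps))" by simp
  have "int m dvd lamp (concat (map lamp_switch ps)) i" for i
  proof -
    have "int m dvd lamp ?w i - lamp (concat (map lamp_switch ps)) i"
      using pres_eq_cursor_lamp ps unfolding pres_class_eq_iff by blast
    moreover have "int m dvd lamp ?w i"
      using same dvd_diff_commute by (auto simp: algebra_simps)
    ultimately show ?thesis
      by (metis dvd_diff diff_diff_eq2 add_diff_cancel_left')
  qed
  then have "lamp_class m ?w = \<one>\<^bsub>lamplighter m\<^esub>"
    unfolding ps by (rule lamp_class_switches_eq_one)
  then have "inv\<^bsub>lamplighter m\<^esub> (lamp_class m u) \<otimes>\<^bsub>lamplighter m\<^esub> lamp_class m v = \<one>\<^bsub>lamplighter m\<^esub>"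
    by (simp add: lamp_class_append lamp_class_inv_gword)
  then show "lamp_class m u = lamp_class m v"
    by (metis inv_equality inv_inv inv_closed lamp_class_carrier)
qed

section \<open>Automata with edges labelled by words\<close>

text \<open>The last argument is the sum of the counter labels along the run, so acceptance requires
  it to be 0. Whole words as labels keep the tour automaton small.\<close>

inductive run :: "('q \<times> 'b list \<times> int \<times> 'q) set \<Rightarrow> 'q set \<Rightarrow> 'q \<Rightarrow> 'b list \<Rightarrow> int \<Rightarrow> bool"
  for E F where
  run_accept: "q \<in> F \<Longrightarrow> run E F q [] 0"
| run_step: "(q, u, h, q') \<in> E \<Longrightarrow> run E F q' w k \<Longrightarrow> run E F q (u @ w) (h + k)"

lemma path_word_simps [simp]:
  "path_word [] = []"
  "path_word ((s, None, h, s') # p) = path_word p"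
  "path_word ((s, Some x, h, s') # p) = x # path_word p"
  by (simp_all add: path_word_def)

lemma path_elem_integer_group [simp]:
  "path_elem integer_group [] = 0"
  "path_elem integer_group ((s, l, h, s') # p) = h + path_elem integer_group p"
  by (simp_all add: path_elem_def word_value_def)

text \<open>An edge labelled by a word is subdivided into edges labelled by its letters; the vertex
  \<open>(u, q)\<close> of the subdivision means that \<open>u\<close> is still to be read before entering \<open>q\<close>.\<close>

lemma one_counter_language_runs:
  fixes E :: "('q \<times> 'b list \<times> int \<times> 'q) set"
  assumes "finite E"
    and letters: "\<And>q u h q' x. (q, u, h, q') \<in> E \<Longrightarrow> x \<in> set u \<Longrightarrow> f x \<in> A"
  shows "one_counter_language A {map f w |w. run E F q0 w 0}"
proof -
  define V :: "('b list \<times> 'q) set" where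
    "V = insert ([], q0) (\<Union>(q, u, h, q')\<in>E. insert ([], q) ((\<lambda>n. (drop n u, q')) ` {..length u}))"
  \<comment> \<open>The edge entering a subdivided edge reads nothing and carries the whole counter
    label \<open>h\<close>; the edges that read letters carry 0.\<close>
  define EE where
    "EE = (\<lambda>(q, u, h, q'). (([], q), None, h, (u, q'))) ` E \<union>
      (\<Union>(q, u, h, q')\<in>E. (\<lambda>n. ((drop n u, q'), Some (f (u ! n)), 0, (drop (Suc n) u, q'))) ` {..<length u})"
  have "finite V" using assms(1) by (auto simp: V_def)
  have "finite EE" using assms(1) by (auto simp: EE_def)
  have V_start: "([], q0) \<in> V" by (simp add: V_def)
  have V_source: "([], q) \<in> V" if "(q, u, h, q') \<in> E" for q u h q'
    using that by (force simp: V_def)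
  have V_suffix: "(v, q') \<in> V" if "(q, u @ v, h, q') \<in> E" for q u v h q'
  proof -
    have "(v, q') \<in> (\<lambda>n. (drop n (u @ v), q')) ` {..length (u @ v)}"
      by (rule image_eqI[of _ _ "length u"]) auto
    then show ?thesis using that unfolding V_def by blast
  qed
  have EE_enter: "(([], q), None, h, (u, q')) \<in> EE" if "(q, u, h, q') \<in> E" for q u h q'
    using that unfolding EE_def by (intro UnI1) force
  have EE_read: "((x # v, q'), Some (f x), 0, (v, q')) \<in> EE"
    if "(q, u @ x # v, h, q') \<in> E" for q u x v h q'
  proof -
    have "((x # v, q'), Some (f x), 0, (v, q')) \<in>
        (\<lambda>n. ((drop n (u @ x # v), q'), Some (f ((u @ x # v) ! n)), 0::int,
          (drop (Suc n) (u @ x # v), q'))) ` {..<length (u @ x # v)}"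
      by (rule image_eqI[of _ _ "length u"]) auto
    then show ?thesis using that unfolding EE_def by blast
  qed
  have EE_cases: "(\<exists>q h u q'. s = ([], q) \<and> l = None \<and> s' = (u, q') \<and> (q, u, h, q') \<in> E \<and> k = h) \<or>
      (\<exists>x v q q' u h. s = (x # v, q') \<and> l = Some (f x) \<and> s' = (v, q') \<and> k = 0
         \<and> (q, u @ x # v, h, q') \<in> E)"
    if "(s, l, k, s') \<in> EE" for s l k s'
  proof (rule ccontr)
    assume neg: "\<not> ?thesis"
    from that obtain q u h q' n where *: "(q, u, h, q') \<in> E" "n < length u" "s = (drop n u, q')"
      "l = Some (f (u ! n))" "k = 0" "s' = (drop (Suc n) u, q')"
      unfolding EE_def using neg by auto
    have "u = take n u @ u ! n # drop (Suc n) u" "drop n u = u ! n # drop (Suc n) u"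
      using *(2) by (simp_all add: id_take_nth_drop Cons_nth_drop_Suc)
    then show False using neg * by metis
  qed
  have EE_V: "s \<in> V \<and> s' \<in> V" if "(s, l, k, s') \<in> EE" for s l k s'
    using EE_cases[OF that]
  proof (elim disjE exE conjE)
    fix q h u q' assume "s = ([], q)" "s' = (u, q')" "(q, u, h, q') \<in> E"
    then show ?thesis using V_source V_suffix[of q "[]" u] by auto
  next
    fix x v q q' u h assume "s = (x # v, q')" "s' = (v, q')" "(q, u @ x # v, h, q') \<in> E"
    then show ?thesis using V_suffix[of q u "x # v"] V_suffix[of q "u @ [x]" v] by auto
  qed
  \<comment> \<open>The vertices must become natural numbers; injectivity on \<open>V\<close> allows
    paths to be pulled back.\<close>
  obtain \<nu> :: "'b list \<times> 'q \<Rightarrow> nat" where inj: "inj_on \<nu> V"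
    using finite_imp_inj_to_nat_seg[OF \<open>finite V\<close>] by blast
  define M :: "(nat, 'a, int) automaton" where
    "M = \<lparr>verts = \<nu> ` V, start = \<nu> ([], q0), accepting = \<nu> ` {s \<in> V. fst s = [] \<and> snd s \<in> F},
      edges = (\<lambda>(s, l, h, s'). (\<nu> s, l, h, \<nu> s')) ` EE\<rparr>"
  have start: "start M = \<nu> ([], q0)" by (simp add: M_def)
  have edgeI: "(\<nu> s, l, h, \<nu> s') \<in> edges M" if "(s, l, h, s') \<in> EE" for s l h s'
    using that by (force simp: M_def)
  \<comment> \<open>Stated for all vertices of the subdivision so that the induction on the path
    works: from \<open>(u, q)\<close> the pending word \<open>u\<close> is read first, then a run
    from \<open>q\<close> follows.\<close>
  have sound: "\<exists>w. run E F q w (path_elem integer_group p) \<and> path_word p = map f (u @ w)"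
    if "is_path M (\<nu> (u, q)) p v" "v \<in> accepting M" "(u, q) \<in> V" for u q p v
    using that
  proof (induction p arbitrary: u q)
    case Nil
    then obtain q' where "\<nu> (u, q) = \<nu> ([], q')" "([], q') \<in> V" "q' \<in> F"
      by (auto simp: M_def)
    then have "u = []" "q \<in> F"
      using inj Nil.prems(3) by (auto dest: inj_onD)
    then show ?case using run_accept[of q F E] by auto
  next
    case (Cons e p)
    obtain y l k y' where "e = (y, l, k, y')" by (cases e)
    with Cons.prems obtain s s' where s: "(s, l, k, s') \<in> EE" "\<nu> s = \<nu> (u, q)" "y' = \<nu> s'"
      "is_path M (\<nu> s') p v"
      by (auto simp: M_def)
    then have s_eq: "s = (u, q)" and "s' \<in> V"
      using inj Cons.prems(3) EE_V[OF s(1)] by (auto dest: inj_onD)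
    from EE_cases[OF s(1)] show ?case
    proof (elim disjE exE conjE)
      fix q1 h u' q' assume *: "s = ([], q1)" "l = None" "s' = (u', q')" "(q1, u', h, q') \<in> E" "k = h"
      then obtain w where "run E F q' w (path_elem integer_group p)" "path_word p = map f (u' @ w)"
        using Cons.IH[of u' q'] s(4) \<open>s' \<in> V\<close> Cons.prems(2) by auto
      then show ?thesis
        using * s_eq \<open>e = _\<close> run_step[of q u' h q' E F w] by (intro exI[of _ "u' @ w"]) auto
    next
      fix x v' q1 q' u' h assume *: "s = (x # v', q')" "l = Some (f x)" "s' = (v', q')" "k = 0"
      then obtain w where "run E F q' w (path_elem integer_group p)" "path_word p = map f (v' @ w)"
        using Cons.IH[of v' q'] s(4) \<open>s' \<in> V\<close> Cons.prems(2) by auto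
      then show ?thesis
        using * s_eq \<open>e = _\<close> by auto
    qed
  qed
  \<comment> \<open>\<open>u0\<close> is the part of the label already read; it keeps the full edge
    in \<open>E\<close> available during the induction.\<close>
  have read: "\<exists>p'. is_path M (\<nu> (u, q')) p' v \<and> path_word p' = map f u @ path_word p \<and>
      path_elem integer_group p' = path_elem integer_group p"
    if "is_path M (\<nu> ([], q')) p v" "(q, u0 @ u, h, q') \<in> E" for p v q u0 u h q'
    using that
  proof (induction u arbitrary: u0)
    case Nil
    then show ?case by auto
  next
    case (Cons x u)
    then obtain p' where "is_path M (\<nu> (u, q')) p' v" "path_word p' = map f u @ path_word p"
      "path_elem integer_group p' = path_elem integer_group p"
      using Cons.IH[of "u0 @ [x]"] by auto
    then show ?case
      using edgeI[OF EE_read[OF Cons.prems(2)]]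
      by (intro exI[of _ "(\<nu> (x # u, q'), Some (f x), 0, \<nu> (u, q')) # p'"]) simp
  qed
  have complete: "\<exists>p. \<exists>v\<in>accepting M. is_path M (\<nu> ([], q)) p v \<and> path_word p = map f w \<and>
      path_elem integer_group p = k"
    if "run E F q w k" "([], q) \<in> V" for q w k
    using that
  proof induction
    case (run_accept q)
    then show ?case by (intro exI[of _ "[]"]) (auto simp: M_def)
  next
    case (run_step q u h q' w k)
    then obtain p v where p: "v \<in> accepting M" "is_path M (\<nu> ([], q')) p v" "path_word p = map f w"
      "path_elem integer_group p = k"
      using V_suffix[of q u "[]"] by auto
    then obtain p' where "is_path M (\<nu> (u, q')) p' v" "path_word p' = map f u @ path_word p"
      "path_elem integer_group p' = path_elem integer_group p"
      using read[of q' p v q "[]" u h] run_step.hyps by auto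
    with p show ?case
      using edgeI[OF EE_enter[OF run_step.hyps(1)]]
      by (intro exI[of _ "(\<nu> ([], q), None, h, \<nu> (u, q')) # p'"]) auto
  qed
  have "group_automaton integer_group A M"
  proof -
    have "Some y = l \<Longrightarrow> y \<in> A" if "(s, l, k, s') \<in> EE" for s l k s' y
      using EE_cases[OF that] letters by force
    then have "edges M \<subseteq> verts M \<times> insert None (Some ` A) \<times> carrier integer_group \<times> verts M"
      using EE_V by (auto simp: M_def) (metis option.exhaust rangeI image_eqI)
    then show ?thesis
      using \<open>finite V\<close> \<open>finite EE\<close> V_start by (auto simp: group_automaton_def M_def)
  qed
  moreover have "accepted_language integer_group M = {map f w |w. run E F q0 w 0}"
  proof (intro equalityI subsetI)
    fix x assume "x \<in> accepted_language integer_group M"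
    then obtain p v where "v \<in> accepting M" "is_path M (\<nu> ([], q0)) p v" "path_word p = x"
      "path_elem integer_group p = 0"
      by (auto simp: accepted_language_def start)
    then show "x \<in> {map f w |w. run E F q0 w 0}"
      using sound[of "[]" q0 p v] V_start by auto
  next
    fix x assume "x \<in> {map f w |w. run E F q0 w 0}"
    then obtain w where "x = map f w" "run E F q0 w 0" by blast
    then show "x \<in> accepted_language integer_group M"
      using complete[of q0 w 0] V_start by (auto simp: accepted_language_def start)
  qed
  ultimately show ?thesis
    unfolding one_counter_language_def by blast
qed

section \<open>Lower bounds on word length\<close>

definition letter_count :: "lamp_sym \<Rightarrow> lamp_sym gword \<Rightarrow> nat" where
  "letter_count x w = length (filter (\<lambda>p. fst p = x) w)"

lemma letter_count_simps [simp]: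
  "letter_count x [] = 0"
  "letter_count x ((y, b) # w) = (if y = x then 1 else 0) + letter_count x w"
  "letter_count x (u @ v) = letter_count x u + letter_count x v"
  "letter_count x (replicate n (y, b)) = (if y = x then n else 0)"
  "letter_count x (gen_pow y i) = (if y = x then nat \<bar>i\<bar> else 0)"
  by (simp_all add: letter_count_def gen_pow_def filter_replicate)

lemma length_eq_letter_counts: "length w = letter_count SymA w + letter_count SymT w"
  by (induction w rule: cursor.induct) auto

lemma abs_cursor_le: "\<bar>cursor w\<bar> \<le> int (letter_count SymT w)"
  by (induction w rule: cursor.induct) (auto simp: sgn_of_def)

text \<open>A letter \<open>a\<close> changes one lamp by 1. A letter \<open>t\<close> only
  translates the configuration, which is why \<open>S\<close> varies in the induction.\<close>

lemma sum_abs_lamp_le: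
  assumes "finite S"
  shows "(\<Sum>i\<in>S. \<bar>lamp w i\<bar>) \<le> int (letter_count SymA w)"
  using assms
proof (induction w arbitrary: S rule: cursor.induct)
  case 1
  then show ?case by simp
next
  case (2 b w)
  have "(\<Sum>i\<in>S. \<bar>lamp ((SymT, b) # w) i\<bar>) = (\<Sum>i\<in>(\<lambda>i. i - sgn_of b) ` S. \<bar>lamp w i\<bar>)"
    by (subst sum.reindex) (auto intro!: inj_onI)
  then show ?case using 2 by simp
next
  case (3 b w)
  have "(\<Sum>i\<in>S. \<bar>lamp ((SymA, b) # w) i\<bar>) \<le> (\<Sum>i\<in>S. (if i = 0 then 1 else 0) + \<bar>lamp w i\<bar>)"
    by (intro sum_mono) (auto simp: sgn_of_def)
  also have "\<dots> \<le> 1 + (\<Sum>i\<in>S. \<bar>lamp w i\<bar>)"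
    using \<open>finite S\<close> by (simp add: sum.distrib)
  finally show ?case using 3 by fastforce
qed

definition visits :: "lamp_sym gword \<Rightarrow> int \<Rightarrow> bool" where
  "visits w i \<longleftrightarrow> (\<exists>u v. w = u @ v \<and> cursor u = i)"

lemma visits_cursor: "visits w (cursor w)"
  unfolding visits_def by (intro exI[of _ w] exI[of _ "[]"]) simp

lemma visits_0: "visits w 0"
  unfolding visits_def by (intro exI[of _ w] exI[of _ "[]"]) force

lemma visits_Cons: "visits w i \<Longrightarrow> visits (p # w) (cursor [p] + i)"
  unfolding visits_def using cursor_append[of "[p]"] by (metis append_Cons append_Nil)

text \<open>A lamp changes only while the cursor stands at it.\<close>

lemma visits_if_lamp:
  assumes "lamp w i \<noteq> 0"
  shows "visits w i"
  using assms
proof (induction w arbitrary: i rule: cursor.induct)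
  case (2 b w)
  then show ?case using visits_Cons[of w "i - sgn_of b" "(SymT, b)"] by simp
next
  case (3 b w)
  then show ?case using visits_Cons[of w i "(SymA, b)"] visits_0 by (auto split: if_splits)
qed simp

text \<open>The positions are reached in one of two orders. Cutting the word at the two prefixes
  gives three pieces, each with at least as many letters \<open>t\<close> as its displacement in
  absolute value.\<close>

lemma letter_count_ge_if_visits:
  assumes "visits w p" "visits w q"
  shows "\<bar>p\<bar> + \<bar>q - p\<bar> + \<bar>cursor w - q\<bar> \<le> int (letter_count SymT w) \<or>
    \<bar>q\<bar> + \<bar>p - q\<bar> + \<bar>cursor w - p\<bar> \<le> int (letter_count SymT w)"
proof -
  have two: "\<bar>cursor x\<bar> + \<bar>cursor x' - cursor x\<bar> + \<bar>cursor w - cursor x'\<bar> \<le> int (letter_count SymT w)"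
    if "w = x @ y" "w = x' @ y'" "x' = x @ z" for x y x' y' z
  proof -
    have "y = z @ y'" using that by simp
    then show ?thesis
      using that abs_cursor_le[of x] abs_cursor_le[of z] abs_cursor_le[of y'] by simp
  qed
  obtain u v u' v' where uv: "w = u @ v" "cursor u = p" "w = u' @ v'" "cursor u' = q"
    using assms unfolding visits_def by metis
  then obtain z where "u' = u @ z \<or> u = u' @ z"
    by (metis append_eq_append_conv2)
  then show ?thesis
    using two[of u v u' v' z] two[of u' v' u v z] uv by auto
qed

section \<open>Shortest tours\<close>

text \<open>Residues of least absolute value. The asymmetric bounds keep \<open>m / 2\<close> but
  not its negative, so that for positive \<open>m\<close> each class has exactly one digit.\<close>

definition digits :: "nat \<Rightarrow> int set" where
  "digits m = {c. - int m < 2 * c \<and> 2 * c \<le> int m}"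

lemma digits_unique:
  assumes "c \<in> digits m" "d \<in> digits m" "int m dvd c - d"
  shows "c = d"
proof (rule ccontr)
  assume "c \<noteq> d"
  then have "int m \<le> \<bar>c - d\<bar>"
    using assms(3) dvd_imp_le_int[of "c - d" "int m"] by simp
  then show False using assms(1,2) by (auto simp: digits_def)
qed

text \<open>Any other member of the class is at least \<open>m\<close> away from \<open>c\<close>,
  whereas \<open>2 * \<bar>c\<bar>\<close> is at most \<open>m\<close>.\<close>

lemma digits_minimal:
  assumes "c \<in> digits m" "int m dvd c - k"
  shows "\<bar>c\<bar> \<le> \<bar>k\<bar>"
proof (cases "c = k")
  case False
  then have "int m \<le> \<bar>c - k\<bar>"
    using assms(2) dvd_imp_le_int[of "c - k" "int m"] by simp
  then show ?thesis using assms(1) by (auto simp: digits_def)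
qed simp

lemma digits_exist:
  assumes "m > 0"
  shows "\<exists>c\<in>digits m. int m dvd c - k"
proof -
  define j where "j = k mod int m"
  have j: "0 \<le> j" "j < int m" "int m dvd j - k"
    using assms by (simp_all add: j_def mod_eq_dvd_iff[symmetric])
  then have "int m dvd j - int m - k"
    by (metis diff_right_commute dvd_diff dvd_refl)
  with j have "j \<in> digits m \<or> j - int m \<in> digits m" "int m dvd j - int m - k"
    by (auto simp: digits_def)
  with j(3) show ?thesis by blast
qed

lemma finite_digits: "finite (digits m)"
  by (rule finite_subset[of _ "{- int m..int m}"]) (auto simp: digits_def)

section \<open>Tours and their lamp configurations\<close>

definition row :: "int list \<Rightarrow> int \<Rightarrow> int" where
  "row cs i = (if 0 \<le> i \<and> i < int (length cs) then cs ! nat i else 0)"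

lemma row_Nil [simp]: "row [] i = 0"
  by (simp add: row_def)

lemma row_negative [simp]: "i < 0 \<Longrightarrow> row cs i = 0"
  by (simp add: row_def)

lemma row_Cons: "row (c # cs) i = (if i = 0 then c else row cs (i - 1))"
  by (auto simp: row_def nth_Cons' nat_diff_distrib)

lemma row_in_digits: "set cs \<subseteq> digits m \<Longrightarrow> m > 0 \<Longrightarrow> row cs i \<in> digits m"
  by (auto simp: row_def digits_def subset_iff)

text \<open>Each step precedes its lamp setting, so the lamp at the starting position is left alone;
  hence the shift by 1 in \<open>lamp_sweep\<close>.\<close>

definition sweep :: "bool \<Rightarrow> int list \<Rightarrow> lamp_sym gword" where
  "sweep e cs = concat (map (\<lambda>c. (SymT, e) # gen_pow SymA c) cs)"

text \<open>\<open>e\<close> is the direction of the sweep. With positions written as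
  \<open>sgn_of e * i\<close>, a tour and its mirror image are treated at once, and \<open>c\<close>
  is the lamp at the first turning point \<open>- l\<close>.\<close>

definition tour :: "bool \<Rightarrow> nat \<Rightarrow> int \<Rightarrow> int list \<Rightarrow> nat \<Rightarrow> lamp_sym gword" where
  "tour e l c cs r =
     replicate l (SymT, \<not> e) @ gen_pow SymA c @ sweep e cs @ replicate r (SymT, \<not> e)"

text \<open>This excludes detours to unlit turning points. For empty \<open>cs\<close> the last lamp
  is \<open>c\<close> itself.\<close>

definition trimmed :: "nat \<Rightarrow> nat \<Rightarrow> int \<Rightarrow> int list \<Rightarrow> nat \<Rightarrow> bool" where
  "trimmed m l c cs r \<longleftrightarrow>
     set (c # cs) \<subseteq> digits m \<and> (l > 0 \<longrightarrow> c \<noteq> 0) \<and> (r > 0 \<longrightarrow> last (c # cs) \<noteq> 0)"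

text \<open>A tour is shortest if its overall displacement goes in the direction of its sweep; zero
  displacement is assigned to one direction only, to keep representatives unique.\<close>

definition efficient :: "nat \<Rightarrow> bool \<Rightarrow> nat \<Rightarrow> int \<Rightarrow> int list \<Rightarrow> nat \<Rightarrow> bool" where
  "efficient m e l c cs r \<longleftrightarrow>
     trimmed m l c cs r \<and> l + r + (if e then 0 else 1) \<le> length cs"

lemma sgn_of_Not: "sgn_of (\<not> e) = - sgn_of e"
  by (simp add: sgn_of_def)

lemma sweep_simps [simp]:
  "sweep e [] = []"
  "sweep e (c # cs) = (SymT, e) # gen_pow SymA c @ sweep e cs"
  by (simp_all add: sweep_def)

lemma cursor_sweep [simp]: "cursor (sweep e cs) = sgn_of e * int (length cs)"
  by (induction cs) (auto simp: algebra_simps)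

lemma lamp_sweep [simp]: "lamp (sweep e cs) (sgn_of e * i) = row cs (i - 1)"
proof (induction cs arbitrary: i)
  case (Cons c cs)
  have "sgn_of e * i - sgn_of e = sgn_of e * (i - 1)"
    by (simp add: algebra_simps)
  then show ?case
    using Cons[of "i - 1"] by (simp add: row_Cons) (simp add: sgn_of_def)
qed simp

lemma cursor_tour: "cursor (tour e l c cs r) = sgn_of e * (int (length cs) - int l - int r)"
  by (simp add: tour_def sgn_of_Not algebra_simps)

lemma lamp_tour: "lamp (tour e l c cs r) (sgn_of e * i) = row (c # cs) (i + int l)"
proof -
  have "sgn_of e * i - sgn_of (\<not> e) * int l = sgn_of e * (i + int l)"
    by (simp add: sgn_of_def)
  then show ?thesis
    by (simp add: tour_def row_Cons) (simp add: sgn_of_def)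
qed

lemma letter_count_sweep [simp]:
  "letter_count SymT (sweep e cs) = length cs"
  "int (letter_count SymA (sweep e cs)) = (\<Sum>c\<leftarrow>cs. \<bar>c\<bar>)"
  by (induction cs) auto

lemma letter_count_tour:
  "letter_count SymT (tour e l c cs r) = l + length cs + r"
  "int (letter_count SymA (tour e l c cs r)) = (\<Sum>c\<leftarrow>c # cs. \<bar>c\<bar>)"
  by (auto simp: tour_def)

text \<open>Letters \<open>a\<close> and \<open>t\<close> are bounded separately. Digits are minimal
  in their class, so the lamps cannot be set with fewer letters \<open>a\<close>. Each turning point
  is lit, or is the initial or final position, so \<open>w\<close> visits both, and either order of
  these visits takes at least as many steps as the tour.\<close>

lemma tour_shortest:
  assumes eff: "efficient m e l c cs r"
    and cursor: "cursor w = cursor (tour e l c cs r)"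
    and lamp: "\<And>i. int m dvd lamp (tour e l c cs r) i - lamp w i"
  shows "length (tour e l c cs r) \<le> length w"
proof -
  let ?s = "sgn_of e" and ?n = "length (c # cs)"
  have dvd: "int m dvd row (c # cs) (i + int l) - lamp w (?s * i)" for i
    using lamp[of "?s * i"] by (simp add: lamp_tour)
  have "(\<Sum>x\<leftarrow>xs. \<bar>x\<bar>) = (\<Sum>j<length xs. \<bar>xs ! j\<bar>)" for xs :: "int list"
    by (simp add: sum_list_sum_nth atLeast0LessThan)
  then have "(\<Sum>c\<leftarrow>c # cs. \<bar>c\<bar>) = (\<Sum>j<?n. \<bar>(c # cs) ! j\<bar>)" .
  also have "\<dots> \<le> (\<Sum>j<?n. \<bar>lamp w (?s * (int j - int l))\<bar>)"
  proof (intro sum_mono digits_minimal)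
    fix j assume j: "j \<in> {..<?n}"
    then show "(c # cs) ! j \<in> digits m"
      using eff unfolding efficient_def trimmed_def by (metis lessThan_iff nth_mem subsetD)
    have "row (c # cs) (int j) = (c # cs) ! j" using j by (simp add: row_def)
    then show "int m dvd (c # cs) ! j - lamp w (?s * (int j - int l))"
      using dvd[of "int j - int l"] by simp
  qed
  also have "\<dots> = (\<Sum>i\<in>(\<lambda>j. ?s * (int j - int l)) ` {..<?n}. \<bar>lamp w i\<bar>)"
    by (subst sum.reindex) (auto intro!: inj_onI simp: sgn_of_def split: if_splits)
  also have "\<dots> \<le> int (letter_count SymA w)"
    by (intro sum_abs_lamp_le) simp
  finally have "int (letter_count SymA (tour e l c cs r)) \<le> int (letter_count SymA w)"
    unfolding letter_count_tour(2) .
  then have a: "letter_count SymA (tour e l c cs r) \<le> letter_count SymA w" by simp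
  \<comment> \<open>By \<open>digits_minimal\<close> a nonzero digit is never congruent to an unlit
    lamp.\<close>
  have visit: "visits w (?s * i)" if "row (c # cs) (i + int l) \<noteq> 0" for i
  proof (rule visits_if_lamp)
    have "row (c # cs) (i + int l) \<in> digits m"
      using eff by (intro row_in_digits) (auto simp: efficient_def trimmed_def digits_def)
    then show "lamp w (?s * i) \<noteq> 0"
      using dvd[of i] digits_minimal that by fastforce
  qed
  have left: "visits w (?s * - int l)"
    using visit[of "- int l"] visits_0 eff by (cases "l = 0") (auto simp: efficient_def trimmed_def row_def)
  have right: "visits w (?s * (int (length cs) - int l))"
  proof (cases "r = 0")
    case True
    then show ?thesis using visits_cursor[of w] by (simp add: cursor cursor_tour)
  next
    case False
    then have "last (c # cs) \<noteq> 0" using eff by (simp add: efficient_def trimmed_def)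
    then have "row (c # cs) (int (length cs)) \<noteq> 0"
      by (simp add: row_def last_conv_nth split: if_splits)
    then show ?thesis using visit[of "int (length cs) - int l"] by simp
  qed
  \<comment> \<open>In the opposite order the visits take \<open>3 * length cs - l - r\<close>
    steps, which is no better because \<open>l + r \<le> length cs\<close>.\<close>
  have "letter_count SymT (tour e l c cs r) \<le> letter_count SymT w"
    using letter_count_ge_if_visits[OF left right] eff
    unfolding cursor cursor_tour letter_count_tour efficient_def trimmed_def
    by (cases e) (auto simp: sgn_of_def)
  with a show ?thesis by (simp add: length_eq_letter_counts)
qed

text \<open>The sign of the displacement determines \<open>e\<close>, with 0 belonging to
  \<open>e = True\<close>. Uniqueness of digits determines the row up to alignment and padding by
  zeros, and the nonzero lamps at turning points fix these.\<close>

lemma efficient_tour_unique: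
  assumes eff: "efficient m e l c cs r" "efficient m e' l' c' cs' r'" and "m > 0"
    and cursor: "cursor (tour e l c cs r) = cursor (tour e' l' c' cs' r')"
    and lamp: "\<And>i. int m dvd lamp (tour e l c cs r) i - lamp (tour e' l' c' cs' r') i"
  shows "tour e l c cs r = tour e' l' c' cs' r'"
proof -
  have "e \<longleftrightarrow> cursor (tour e l c cs r) \<ge> 0" if "efficient m e l c cs r" for e l c cs r
    using that by (auto simp: cursor_tour efficient_def trimmed_def sgn_of_def split: if_splits)
  then have e: "e' = e" using eff cursor by metis
  have n: "int (length cs) - int l - int r = int (length cs') - int l' - int r'"
    using cursor by (simp add: e cursor_tour sgn_of_def split: if_splits)
  have row: "row (c # cs) (i + int l) = row (c' # cs') (i + int l')" for i
  proof (rule digits_unique)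
    show "row (c # cs) (i + int l) \<in> digits m" "row (c' # cs') (i + int l') \<in> digits m"
      using eff \<open>m > 0\<close> by (auto simp: efficient_def trimmed_def intro!: row_in_digits)
    show "int m dvd row (c # cs) (i + int l) - row (c' # cs') (i + int l')"
      using lamp[of "sgn_of e * i"] by (simp add: e lamp_tour)
  qed
  have first: "row (c # cs) 0 = c" for c cs by (simp add: row_def)
  have last: "row (c # cs) (int (length cs)) = last (c # cs)" for c cs
    by (simp add: row_def last_conv_nth)
  have out: "row (c # cs) i = 0" if "i < 0 \<or> i > int (length cs)" for c cs i
    using that by (auto simp: row_def)
  \<comment> \<open>If one tour reached further back, its lit turning point would lie outside the
    row of the other.\<close>
  have "l = l'"
  proof (rule linorder_cases[of l l'])
    assume "l < l'"
    then show ?thesis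
      using row[of "- int l'"] out[of "int l - int l'" cs c] first[of c' cs'] eff
      by (simp add: efficient_def trimmed_def)
  next
    assume "l' < l"
    then show ?thesis
      using row[of "- int l"] out[of "int l' - int l" cs' c'] first[of c cs] eff
      by (simp add: efficient_def trimmed_def)
  qed
  \<comment> \<open>With equal \<open>l\<close> and equal displacement the longer sweep has the
    longer return, so its last lamp is nonzero and lies beyond the other row.\<close>
  moreover have "length cs = length cs'"
  proof (rule linorder_cases[of "length cs" "length cs'"])
    assume "length cs < length cs'"
    then show ?thesis
      using row[of "int (length cs') - int l'"] out[of "int (length cs')" cs c] last[of c' cs'] eff
        n \<open>l = l'\<close>
      by (simp add: efficient_def trimmed_def)
  next
    assume "length cs' < length cs"
    then show ?thesis
      using row[of "int (length cs) - int l"] out[of "int (length cs)" cs' c'] last[of c cs] eff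
        n \<open>l = l'\<close>
      by (simp add: efficient_def trimmed_def)
  qed
  moreover have "(c # cs) ! j = (c' # cs') ! j" if "j < length (c # cs)" for j
    using row[of "int j - int l"] that calculation by (simp add: row_def)
  then have "c # cs = c' # cs'"
    using calculation by (intro nth_equalityI) auto
  ultimately show ?thesis using n e by simp
qed

section \<open>Existence of efficient tours\<close>

lemma finite_lamp: "finite {i. lamp w i \<noteq> 0}"
proof (induction w rule: cursor.induct)
  case (2 b w)
  have "{i. lamp ((SymT, b) # w) i \<noteq> 0} = (\<lambda>i. i + sgn_of b) ` {i. lamp w i \<noteq> 0}"
    by (force simp: image_iff intro!: exI[of _ "_ - sgn_of b"])
  then show ?case using 2 by simp
next
  case (3 b w)
  have "{i. lamp ((SymA, b) # w) i \<noteq> 0} \<subseteq> insert 0 {i. lamp w i \<noteq> 0}" by auto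
  then show ?case using 3 finite_subset by blast
qed simp

text \<open>The tour spans the smallest interval containing 0, the final position and all nonzero
  digits, oriented so that the final position is not negative.\<close>

lemma efficient_tour_exists:
  assumes "m > 0"
  shows "\<exists>e l c cs r. efficient m e l c cs r \<and> cursor (tour e l c cs r) = cursor w \<and>
    (\<forall>i. int m dvd lamp (tour e l c cs r) i - lamp w i)"
proof -
  define e where "e \<longleftrightarrow> cursor w \<ge> 0"
  define n where "n = \<bar>cursor w\<bar>"
  have n: "cursor w = sgn_of e * n" "n \<ge> 0" "\<not> e \<Longrightarrow> n > 0"
    by (auto simp: e_def n_def sgn_of_def)
  have "\<exists>g. \<forall>i. (g i \<in> digits m \<and> int m dvd g i - lamp w (sgn_of e * i)) "
    using digits_exist[OF assms] by (intro choice) blast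
  then obtain g where g: "\<And>i. g i \<in> digits m" "\<And>i. int m dvd g i - lamp w (sgn_of e * i)"
    by blast
  have "0 \<in> digits m" using assms by (simp add: digits_def)
  \<comment> \<open>By minimality the digit of an unlit lamp is 0, so \<open>g\<close> has finite
    support.\<close>
  then have "{i. g i \<noteq> 0} \<subseteq> (\<lambda>i. sgn_of e * i) ` {i. lamp w i \<noteq> 0}"
  proof -
    have "i \<in> (\<lambda>i. sgn_of e * i) ` {i. lamp w i \<noteq> 0}" if "g i \<noteq> 0" for i
    proof (rule image_eqI[of _ _ "sgn_of e * i"])
      show "i = sgn_of e * (sgn_of e * i)" by (simp add: sgn_of_def)
      show "sgn_of e * i \<in> {i. lamp w i \<noteq> 0}"
        using digits_minimal[OF g(1)[of i] g(2)[of i]] that by auto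
    qed
    then show ?thesis by blast
  qed
  then have fin: "finite {i. g i \<noteq> 0}"
    using finite_lamp finite_subset by blast
  \<comment> \<open>Inserting 0 and \<open>n\<close> makes the extrema well defined. Wherever the
    interval goes beyond these, it ends at a nonzero digit, as \<open>trimmed\<close>
    demands.\<close>
  define lo where "lo = Min (insert 0 {i. g i \<noteq> 0})"
  define hi where "hi = Max (insert n {i. g i \<noteq> 0})"
  have lo: "lo \<le> 0" "\<And>i. g i \<noteq> 0 \<Longrightarrow> lo \<le> i" "lo = 0 \<or> g lo \<noteq> 0"
    using fin Min_in[of "insert 0 {i. g i \<noteq> 0}"] by (auto simp: lo_def)
  have hi: "n \<le> hi" "\<And>i. g i \<noteq> 0 \<Longrightarrow> i \<le> hi" "hi = n \<or> g hi \<noteq> 0"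
    using fin Max_in[of "insert n {i. g i \<noteq> 0}"] by (auto simp: hi_def)
  define cs where "cs = map g [lo + 1..hi]"
  define l where "l = nat (- lo)"
  define r where "r = nat (hi - n)"
  have cs: "g lo # cs = map g [lo..hi]"
    using lo(1) hi(1) n(2) by (simp add: cs_def upto_rec1)
  have len: "int (length cs) = hi - lo" and l: "int l = - lo" and r: "int r = hi - n"
    using lo(1) hi(1) n(2) by (simp_all add: cs_def l_def r_def)
  have "last (g lo # cs) = g hi"
    unfolding cs using lo(1) hi(1) n(2) by (simp add: last_map last_conv_nth)
  \<comment> \<open>The oriented displacement \<open>length cs - l - r\<close> is \<open>n\<close>,
    which is positive if \<open>e\<close> is false.\<close>
  moreover have "int (l + r + (if e then 0 else 1)) \<le> int (length cs)"
    using n len l r by (cases e) auto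
  then have "l + r + (if e then 0 else 1) \<le> length cs" by linarith
  moreover have "set (g lo # cs) \<subseteq> digits m" using g(1) by (auto simp: cs_def)
  ultimately have "efficient m e l (g lo) cs r"
    using lo(3) hi(3) l r unfolding efficient_def trimmed_def by auto
  moreover have "cursor (tour e l (g lo) cs r) = cursor w"
    by (simp add: cursor_tour len l r n(1))
  moreover have "int m dvd lamp (tour e l (g lo) cs r) i - lamp w i" for i
  proof -
    define j where "j = sgn_of e * i"
    have i: "i = sgn_of e * j" by (simp add: j_def sgn_of_def)
    have "row (g lo # cs) (j + int l) = g j"
    proof (cases "lo \<le> j \<and> j \<le> hi")
      case True
      then show ?thesis
        using lo(1) hi(1) n(2) unfolding cs by (simp add: row_def l)
    next
      case False
      then have "g j = 0" using lo(2) hi(2) by blast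
      with False show ?thesis unfolding cs by (simp add: row_def l)
    qed
    then show ?thesis using g(2)[of j] by (simp add: i lamp_tour)
  qed
  ultimately show ?thesis by blast
qed

section \<open>An automaton for shortest tours\<close>

datatype phase = Start | Out | Sweep | Back | Stop

text \<open>The counter holds the position of the cursor, oriented so that the sweep goes upwards;
  \<open>Stop\<close> accepts exactly if the final value has the sign demanded by \<^const>\<open>efficient\<close>. The phase
  \<open>Back\<close> is entered by a non-deterministic guess that the last nonzero lamp has been set.\<close>

inductive_set tour_edges :: "nat \<Rightarrow> ((bool \<times> phase) \<times> lamp_sym gword \<times> int \<times> (bool \<times> phase)) set"
  for m where
  edge_switch: "((True, Start), [], 0, (False, Start)) \<in> tour_edges m"
| edge_out: "s \<in> {Start, Out} \<Longrightarrow> ((e, s), [(SymT, \<not> e)], - 1, (e, Out)) \<in> tour_edges m"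
| edge_first: "\<lbrakk>s \<in> {Start, Out}; s' \<in> {Sweep, Back}; c \<in> digits m; s = Out \<or> s' = Back \<Longrightarrow> c \<noteq> 0\<rbrakk>
    \<Longrightarrow> ((e, s), gen_pow SymA c, 0, (e, s')) \<in> tour_edges m"
| edge_sweep: "\<lbrakk>s' \<in> {Sweep, Back}; c \<in> digits m; s' = Back \<Longrightarrow> c \<noteq> 0\<rbrakk>
    \<Longrightarrow> ((e, Sweep), (SymT, e) # gen_pow SymA c, 1, (e, s')) \<in> tour_edges m"
| edge_back: "((e, Back), [(SymT, \<not> e)], - 1, (e, Back)) \<in> tour_edges m"
| edge_stop: "s \<in> {Sweep, Back} \<Longrightarrow> ((e, s), [], if e then 0 else - 1, (e, Stop)) \<in> tour_edges m"
| edge_decrease: "((e, Stop), [], - 1, (e, Stop)) \<in> tour_edges m"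

abbreviation tour_run :: "nat \<Rightarrow> bool \<times> phase \<Rightarrow> lamp_sym gword \<Rightarrow> int \<Rightarrow> bool" where
  "tour_run m \<equiv> run (tour_edges m) (UNIV \<times> {Stop})"

lemma finite_tour_edges: "finite (tour_edges m)"
proof (rule finite_subset)
  define P :: "(bool \<times> phase) set" where "P = UNIV \<times> {Start, Out, Sweep, Back, Stop}"
  define W :: "lamp_sym gword set" where "W = insert [] ((\<lambda>e. [(SymT, e)]) ` UNIV \<union>
    gen_pow SymA ` digits m \<union> (\<lambda>(e, c). (SymT, e) # gen_pow SymA c) ` (UNIV \<times> digits m))"
  show "tour_edges m \<subseteq> P \<times> W \<times> {- 1, 0, 1} \<times> P"
  proof
    fix x assume x: "x \<in> tour_edges m"
    obtain e s u h e' s' where "x = ((e, s), u, h, (e', s'))" by (metis surj_pair)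
    with x have "((e, s), u, h, (e', s')) \<in> tour_edges m" by simp
    then have "((e, s), u, h, (e', s')) \<in> P \<times> W \<times> {- 1, 0, 1} \<times> P"
      by cases (auto simp: P_def W_def)
    then show "x \<in> P \<times> W \<times> {- 1, 0, 1} \<times> P"
      by (simp add: \<open>x = _\<close>)
  qed
  show "finite (P \<times> W \<times> {- 1, 0, 1::int} \<times> P)"
    by (auto simp: P_def W_def finite_digits)
qed

section \<open>Soundness of the tour automaton\<close>

definition end_cost :: "bool \<Rightarrow> int" where
  "end_cost e = (if e then 0 else 1)"

text \<open>What can still be read, and which counter sums can still arise, from each state. The
  sums are only bounded above, since the loop at \<open>Stop\<close> may decrease them at will;
  \<open>end_cost\<close> is the least admissible displacement. In \<open>Out\<close> a step outward
  has already been taken, whence \<open>Suc l\<close>; in \<open>Sweep\<close> the dummy lamp 0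
  forbids a return before a further lamp is set. The direction can switch only from
  \<open>True\<close> to \<open>False\<close>.\<close>

fun tour_suffix :: "nat \<Rightarrow> bool \<times> phase \<Rightarrow> lamp_sym gword \<Rightarrow> int \<Rightarrow> bool" where
  "tour_suffix m (e, Start) w k \<longleftrightarrow> (\<exists>e' l c cs r. w = tour e' l c cs r \<and> trimmed m l c cs r
     \<and> k \<le> int (length cs) - int l - int r - end_cost e' \<and> (e' \<longrightarrow> e))"
| "tour_suffix m (e, Out) w k \<longleftrightarrow> (\<exists>l c cs r. w = tour e l c cs r \<and> trimmed m (Suc l) c cs r
     \<and> k \<le> int (length cs) - int l - int r - end_cost e)"
| "tour_suffix m (e, Sweep) w k \<longleftrightarrow> (\<exists>cs r. w = sweep e cs @ replicate r (SymT, \<not> e)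
     \<and> trimmed m 0 0 cs r \<and> k \<le> int (length cs) - int r - end_cost e)"
| "tour_suffix m (e, Back) w k \<longleftrightarrow> (\<exists>r. w = replicate r (SymT, \<not> e) \<and> k \<le> - int r - end_cost e)"
| "tour_suffix m (e, Stop) w k \<longleftrightarrow> w = [] \<and> k \<le> 0"

text \<open>Unites the two guesses possible when lamp \<open>c\<close> is set: \<open>Back\<close>
  needs \<open>c\<close> nonzero, and \<open>Sweep\<close> with no further lamp forces
  \<open>r = 0\<close>.\<close>

lemma tour_suffix_deposit:
  assumes "tour_suffix m (e, s) w k" "s \<in> {Sweep, Back}" "c \<in> digits m" "s = Back \<Longrightarrow> c \<noteq> 0"
  obtains cs r where "w = sweep e cs @ replicate r (SymT, \<not> e)" "trimmed m 0 c cs r"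
    "k \<le> int (length cs) - int r - end_cost e"
proof (cases s)
  case Sweep
  then show ?thesis using that assms by (fastforce simp: trimmed_def split: if_splits)
next
  case Back
  then obtain r where "w = replicate r (SymT, \<not> e)" "k \<le> - int r - end_cost e"
    using assms by auto
  then show ?thesis using that[of "[]" r] assms Back by (simp add: trimmed_def)
qed (use assms in auto)

lemma tour_run_suffix:
  assumes "tour_run m q w k" "m > 0"
  shows "tour_suffix m q w k"
  using assms(1)
proof (induction rule: run.induct)
  case (run_accept q)
  then show ?case by auto
next
  case (run_step q u h q' w k)
  obtain e s e' s' where q: "q = (e, s)" "q' = (e', s')" by fastforce
  note IH = run_step.IH[unfolded q]
  from run_step.hyps(1)[unfolded q] have "tour_suffix m (e, s) (u @ w) (h + k)"
  proof cases
    case edge_switch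
    then have "tour_suffix m (False, Start) w k" using IH by simp
    then show ?thesis using edge_switch by fastforce
  next
    case edge_out
    then obtain l c cs r where *: "w = tour e l c cs r" "trimmed m (Suc l) c cs r"
      "k \<le> int (length cs) - int l - int r - end_cost e"
      using IH by auto
    then have **: "u @ w = tour e (Suc l) c cs r" using edge_out by (simp add: tour_def)
    from \<open>s \<in> {Start, Out}\<close> consider "s = Start" | "s = Out" by auto
    then show ?thesis
    proof cases
      case 1
      have "tour_suffix m (e, Start) (u @ w) (h + k)"
        unfolding tour_suffix.simps
        using * ** edge_out by (intro exI[of _ e] exI[of _ "Suc l"] exI[of _ c] exI[of _ cs] exI[of _ r]) auto
      then show ?thesis using edge_out 1 by simp
    next
      case 2
      have "tour_suffix m (e, Out) (u @ w) (h + k)"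
        unfolding tour_suffix.simps
        using * ** edge_out by (intro exI[of _ "Suc l"] exI[of _ c] exI[of _ cs] exI[of _ r])
          (auto simp: trimmed_def)
      then show ?thesis using edge_out 2 by simp
    qed
  next
    case (edge_first c)
    obtain cs r where *: "w = sweep e cs @ replicate r (SymT, \<not> e)" "trimmed m 0 c cs r"
      "k \<le> int (length cs) - int r - end_cost e"
      by (rule tour_suffix_deposit[of m e s' w k c]) (use IH edge_first in auto)
    then have **: "u @ w = tour e 0 c cs r" using edge_first by (simp add: tour_def)
    from \<open>s \<in> {Start, Out}\<close> consider "s = Start" | "s = Out" "c \<noteq> 0" using edge_first by auto
    then show ?thesis
    proof cases
      case 1
      have "tour_suffix m (e, Start) (u @ w) (h + k)"
        unfolding tour_suffix.simps
        using * ** edge_first by (intro exI[of _ e] exI[of _ 0] exI[of _ c] exI[of _ cs] exI[of _ r]) auto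
      then show ?thesis using edge_first 1 by simp
    next
      case 2
      have "tour_suffix m (e, Out) (u @ w) (h + k)"
        unfolding tour_suffix.simps
        using * ** edge_first 2 by (intro exI[of _ 0] exI[of _ c] exI[of _ cs] exI[of _ r])
          (auto simp: trimmed_def)
      then show ?thesis using edge_first 2 by simp
    qed
  next
    case (edge_sweep c)
    obtain cs r where *: "w = sweep e cs @ replicate r (SymT, \<not> e)" "trimmed m 0 c cs r"
      "k \<le> int (length cs) - int r - end_cost e"
      by (rule tour_suffix_deposit[of m e s' w k c]) (use IH edge_sweep in auto)
    have "tour_suffix m (e, Sweep) (u @ w) (h + k)"
      unfolding tour_suffix.simps
      using * edge_sweep by (intro exI[of _ "c # cs"] exI[of _ r]) (auto simp: trimmed_def digits_def)
    then show ?thesis using edge_sweep by simp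
  next
    case edge_back
    then obtain r where "w = replicate r (SymT, \<not> e)" "k \<le> - int r - end_cost e"
      using IH by auto
    then show ?thesis using edge_back by (auto intro!: exI[of _ "Suc r"])
  next
    case edge_stop
    from \<open>s \<in> {Sweep, Back}\<close> consider "s = Sweep" | "s = Back" by auto
    then show ?thesis
    proof cases
      case 1
      have "tour_suffix m (e, Sweep) (u @ w) (h + k)"
        unfolding tour_suffix.simps
        using IH edge_stop \<open>m > 0\<close>
        by (intro exI[of _ "[]"] exI[of _ 0]) (auto simp: trimmed_def digits_def end_cost_def)
      then show ?thesis using edge_stop 1 by simp
    next
      case 2
      then show ?thesis using IH edge_stop by (auto simp: end_cost_def)
    qed
  next
    case edge_decrease
    then show ?thesis using IH by auto
  qed
  then show ?case by (simp only: q)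
qed

section \<open>Completeness of the tour automaton\<close>

lemma run_stepI:
  assumes "(q, u, h, q') \<in> E" "run E F q' w k" "v = u @ w" "l = h + k"
  shows "run E F q v l"
  unfolding assms(3,4) using assms(1,2) by (rule run_step)

text \<open>\<open>j\<close> counts the rounds of the decreasing loop. The next lemmas carry it
  along as the surplus to be removed at the end.\<close>

lemma tour_run_stop: "tour_run m (e, Stop) [] (- int j)"
proof (induction j)
  case 0
  then show ?case using run_accept[of "(e, Stop)" "UNIV \<times> {Stop}"] by simp
next
  case (Suc j)
  show ?case by (rule run_stepI[OF edge_decrease Suc]) simp_all
qed

lemma tour_run_stop':
  assumes "s \<in> {Sweep, Back}"
  shows "tour_run m (e, s) [] (- end_cost e - int j)"
  by (rule run_stepI[OF edge_stop[OF assms] tour_run_stop[of m e j]]) (simp_all add: end_cost_def)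

lemma tour_run_back:
  "tour_run m (e, Back) (replicate r (SymT, \<not> e)) (- int r - end_cost e - int j)"
proof (induction r)
  case 0
  show ?case using tour_run_stop'[of Back m e j] by simp
next
  case (Suc r)
  show ?case by (rule run_stepI[OF edge_back Suc]) simp_all
qed

text \<open>The right guess is \<open>Back\<close> if no lamp is left and \<open>r > 0\<close>,
  where \<open>trimmed\<close> makes \<open>c\<close> nonzero, and \<open>Sweep\<close>
  otherwise.\<close>

lemma tour_run_deposit:
  assumes "trimmed m 0 c cs r"
  shows "\<exists>s\<in>{Sweep, Back}. (s = Back \<longrightarrow> c \<noteq> 0) \<and>
    tour_run m (e, s) (sweep e cs @ replicate r (SymT, \<not> e))
      (int (length cs) - int r - end_cost e - int j)"
  using assms
proof (induction cs arbitrary: c)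
  case Nil
  show ?case
  proof (cases "r = 0")
    case True
    then show ?thesis using tour_run_stop'[of Sweep m e j] by (intro bexI[of _ Sweep]) auto
  next
    case False
    then show ?thesis
      using tour_run_back[of m e r j] Nil by (intro bexI[of _ Back]) (auto simp: trimmed_def)
  qed
next
  case (Cons d cs)
  then have d: "d \<in> digits m" "trimmed m 0 d cs r" by (auto simp: trimmed_def)
  then obtain s where s: "s \<in> {Sweep, Back}" "s = Back \<Longrightarrow> d \<noteq> 0"
    "tour_run m (e, s) (sweep e cs @ replicate r (SymT, \<not> e))
      (int (length cs) - int r - end_cost e - int j)"
    using Cons.IH[OF d(2)] by auto
  show ?case
    by (intro bexI[of _ Sweep] conjI impI run_stepI[OF edge_sweep[OF s(1) d(1) s(2)] s(3)])
      simp_all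
qed

lemma tour_run_tour:
  assumes "trimmed m l c cs r" "s \<in> {Start, Out}" "s = Out \<Longrightarrow> c \<noteq> 0"
  shows "tour_run m (e, s) (tour e l c cs r)
    (int (length cs) - int l - int r - end_cost e - int j)"
  using assms
proof (induction l arbitrary: s)
  case 0
  then obtain s' where s': "s' \<in> {Sweep, Back}" "s' = Back \<Longrightarrow> c \<noteq> 0"
    "tour_run m (e, s') (sweep e cs @ replicate r (SymT, \<not> e))
      (int (length cs) - int r - end_cost e - int j)"
    using tour_run_deposit[of m c cs r e j] by auto
  have "c \<in> digits m" using 0 by (simp add: trimmed_def)
  then have "((e, s), gen_pow SymA c, 0, (e, s')) \<in> tour_edges m"
    using 0 s' by (intro edge_first) auto
  then show ?case by (rule run_stepI[OF _ s'(3)]) (simp_all add: tour_def)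
next
  case (Suc l)
  then have "tour_run m (e, Out) (tour e l c cs r)
      (int (length cs) - int l - int r - end_cost e - int j)"
    by (intro Suc.IH) (auto simp: trimmed_def)
  then show ?case
    by (rule run_stepI[OF edge_out[OF Suc.prems(2)]]) (simp_all add: tour_def)
qed

lemma tour_run_iff:
  assumes "m > 0"
  shows "tour_run m (True, Start) w 0 \<longleftrightarrow> (\<exists>e l c cs r. w = tour e l c cs r \<and> efficient m e l c cs r)"
proof
  assume "tour_run m (True, Start) w 0"
  then obtain e l c cs r where "w = tour e l c cs r" "trimmed m l c cs r"
    "0 \<le> int (length cs) - int l - int r - end_cost e"
    using tour_run_suffix[OF _ assms] by fastforce
  moreover from this have "l + r + (if e then 0 else 1) \<le> length cs"
    by (cases e) (simp_all add: end_cost_def)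
  ultimately show "\<exists>e l c cs r. w = tour e l c cs r \<and> efficient m e l c cs r"
    unfolding efficient_def by blast
next
  assume "\<exists>e l c cs r. w = tour e l c cs r \<and> efficient m e l c cs r"
  then obtain e l c cs r where w: "w = tour e l c cs r" and eff: "efficient m e l c cs r" by blast
  \<comment> \<open>Surplus over the least admissible displacement; the natural subtraction is exact
    by \<open>efficient\<close>.\<close>
  define j where "j = length cs - l - r - (if e then 0 else 1)"
  have "int (length cs) - int l - int r - end_cost e - int j = 0"
    using eff by (auto simp: j_def efficient_def end_cost_def)
  then have run: "tour_run m (e, Start) w 0"
    using tour_run_tour[of m l c cs r Start e j] eff by (simp add: efficient_def w)
  show "tour_run m (True, Start) w 0"
  proof (cases e)
    case False
    with run have "tour_run m (False, Start) w 0" by simp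
    then show ?thesis by (rule run_stepI[OF edge_switch]) simp_all
  qed (use run in simp)
qed

section \<open>Words over the generators\<close>

lemma lamp_letter_inv: "lamp_class m [(x, False)] = inv\<^bsub>lamplighter m\<^esub> (lamp_class m [(x, True)])"
  using lamp_class_inv_gword[of m "[(x, True)]"]
  by (simp only: inv_gword_Cons inv_gword_Nil append_Nil not_True_eq_False)

text \<open>For \<open>m = 2\<close> the generator \<open>a\<close> equals its inverse, so signed
  symbols may name the same letter twice; the range takes care of this.\<close>

lemma alphabet_lamplighter:
  "alphabet (lamplighter m) {lamp_a m, lamp_t m} = range (\<lambda>p. lamp_class m [p])"
proof -
  have "x = SymA \<or> x = SymT" for x by (cases x) auto
  then have letters: "UNIV = {(SymA, True), (SymT, True), (SymA, False), (SymT, False)}" by auto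
  have "range (\<lambda>p. lamp_class m [p]) =
      {lamp_class m [(SymA, True)], lamp_class m [(SymT, True)],
       lamp_class m [(SymA, False)], lamp_class m [(SymT, False)]}"
    unfolding letters image_insert image_empty by (rule HOL.refl)
  then show ?thesis
    unfolding alphabet_def lamp_a_def lamp_t_def pres_gen_def lamp_letter_inv
    by (simp only: image_insert image_empty Un_insert_left Un_empty_left)
qed

lemma word_value_lamp_letters:
  "word_value (lamplighter m) (map (\<lambda>p. lamp_class m [p]) w) = lamp_class m w"
proof (induction w)
  case Nil
  show ?case by (simp only: word_value_def list.map foldr.simps id_apply lamp_class_Nil)
next
  case (Cons p w)
  then show ?case
    using lamp_class_append[of m "[p]" w]
    by (simp only: word_value_def list.map foldr.simps o_apply append.simps)
qed

lemma geodesicI: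
  assumes "w \<in> lists (alphabet G X)"
    and "\<And>v. \<lbrakk>v \<in> lists (alphabet G X); word_value G v = word_value G w\<rbrakk> \<Longrightarrow> length w \<le> length v"
  shows "geodesic G X w"
  unfolding geodesic_def word_length_def
  using assms by (intro conjI HOL.sym[OF Least_equality]) auto

theorem theorem17:
  fixes m :: nat
  assumes "m \<ge> 2"
  shows "\<exists>L. (\<forall>w\<in>L. geodesic (lamplighter m) {lamp_a m, lamp_t m} w) \<and>
             (\<forall>g\<in>carrier (lamplighter m). \<exists>!w. w \<in> L \<and> word_value (lamplighter m) w = g) \<and>
             one_counter_language (alphabet (lamplighter m) {lamp_a m, lamp_t m}) L"
proof -
  have "m > 0" using assms by simp
  let ?f = "\<lambda>p. lamp_class m [p]" and ?A = "alphabet (lamplighter m) {lamp_a m, lamp_t m}"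
  define L where "L = {map ?f w |w. tour_run m (True, Start) w 0}"
  have L_iff: "v \<in> L \<longleftrightarrow> (\<exists>e l c cs r. v = map ?f (tour e l c cs r) \<and> efficient m e l c cs r)" for v
    unfolding L_def tour_run_iff[OF \<open>m > 0\<close>] by blast
  have words: "\<exists>w. v = map ?f w" if "v \<in> lists ?A" for v
    using that unfolding alphabet_lamplighter lists_image by blast
  have "geodesic (lamplighter m) {lamp_a m, lamp_t m} v" if in_L: "v \<in> L" for v
  proof (rule geodesicI)
    obtain e l c cs r where v: "v = map ?f (tour e l c cs r)" "efficient m e l c cs r"
      using iffD1[OF L_iff in_L] by blast
    show "v \<in> lists ?A" unfolding v(1) alphabet_lamplighter lists_image by blast
    fix u assume u: "u \<in> lists ?A" "word_value (lamplighter m) u = word_value (lamplighter m) v"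
    \<comment> \<open>The comparison moves to signed words, where mapping to letters preserves
      length.\<close>
    obtain w where w: "u = map ?f w" using words[OF u(1)] by blast
    have "lamp_class m (tour e l c cs r) = lamp_class m w"
      using HOL.sym[OF u(2)] unfolding v(1) w word_value_lamp_letters .
    then show "length v \<le> length u"
      using tour_shortest[OF v(2), of w] unfolding lamp_class_eq_iff by (simp add: v(1) w)
  qed
  moreover have "\<exists>!v. v \<in> L \<and> word_value (lamplighter m) v = g"
    if in_G: "g \<in> carrier (lamplighter m)" for g
  proof -
    obtain w where g: "g = lamp_class m w"
      using in_G unfolding lamplighter_def by (elim carrier_presented_groupE)
    obtain e l c cs r where *: "efficient m e l c cs r" "lamp_class m (tour e l c cs r) = g"
      using efficient_tour_exists[OF \<open>m > 0\<close>, of w] unfolding g lamp_class_eq_iff by blast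
    show ?thesis
    proof (rule ex1I[of _ "map ?f (tour e l c cs r)"])
      show "map ?f (tour e l c cs r) \<in> L \<and>
          word_value (lamplighter m) (map ?f (tour e l c cs r)) = g"
        unfolding L_iff word_value_lamp_letters using * by blast
      fix v assume v: "v \<in> L \<and> word_value (lamplighter m) v = g"
      obtain e' l' c' cs' r' where v': "v = map ?f (tour e' l' c' cs' r')"
        "efficient m e' l' c' cs' r'"
        using iffD1[OF L_iff conjunct1[OF v]] by blast
      have "word_value (lamplighter m) v = lamp_class m (tour e l c cs r)"
        using v *(2) by simp
      then have "lamp_class m (tour e' l' c' cs' r') = lamp_class m (tour e l c cs r)"
        unfolding v'(1) word_value_lamp_letters .
      then have "tour e' l' c' cs' r' = tour e l c cs r"
        unfolding lamp_class_eq_iff using v'(2) *(1) \<open>m > 0\<close>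
        by (intro efficient_tour_unique[of m]) auto
      then show "v = map ?f (tour e l c cs r)" using v' by simp
    qed
  qed
  moreover have "one_counter_language ?A L"
    unfolding L_def
    unfolding alphabet_lamplighter
    by (rule one_counter_language_runs[OF finite_tour_edges]) (rule rangeI)
  ultimately show ?thesis by (intro exI[of _ L] conjI ballI)
qed

end
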